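(* Let $\Lambda=(\lambda_{ij})$ be an $n\times n$ matrix of nonzero complex numbers with $\sum_i\lambda_{ij}=1$ for every $j$ and $\sum_j\lambda_{ij}=1$ for every $i$. Consider the (multi-valued) function $$\mathrm{e}^F=\frac{\prod_{i,j}(g_{ij})^{\lambda_{ji}}}{\det g}$$ of $g=(g_{ij})\in\mathbf{GL}(n,\mathbb{C})$ with all $g_{ij}\ne 0$, regarded as a function on the corresponding open subset of $X=\mathbf{GL}(n,\mathbb{C})/T$. Then the critical points of this function are the solutions to the problem of classification of two complete systems of orthogonal rank $1$ projectors $\{p_i\}$ and $\{q_j\}$ in $\mathbb{C}^n$ satisfying $$\mathrm{Tr}(p_iq_j)=\lambda_{ij}\quad\text{for all } i,j;$$ that is, with $\{q_j\}$ the fixed coordinate projectors and $p_i=gq_ig^{-1}$, the critical points $gT\in X$ are exactly the complete systems $\{p_i\}$ of orthogonal rank $1$ projectors satisfying these equations.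
   Context: A projector is an idempotent matrix (not necessarily Hermitian); a complete system of orthogonal rank $1$ projectors in $\mathbb{C}^n$ is a sequence of $n$ projectors of rank $1$ with pairwise products $0$. $q_1,\dots,q_n$ are the projectors onto the coordinate axes of $\mathbb{C}^n$ (the diagonal matrix units), $T$ is the torus of invertible diagonal matrices, acting on $\mathbf{GL}(n,\mathbb{C})$ by right multiplication, and $X=\mathbf{GL}(n,\mathbb{C})/T$ is identified with the variety of complete systems of orthogonal rank $1$ projectors by $g\mapsto(p_i=gq_ig^{-1})_i$. The logarithm of the function is $F=\sum_{i,j}\lambda_{ij}\log g_{ji}-\log\det g$. It is multi-valued, but $\mathrm{d}F$ is a well-defined $1$-form that descends to $X$. A critical point of $\mathrm{e}^F$ is a point where $\mathrm{d}F=0$ (equivalently, where any local branch of $\mathrm{e}^F$ has zero differential). *)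

theory Defs
  imports "HOL-Analysis.Analysis"
begin

definition GL :: "(complex^'n^'n) set" where
  "GL = {g. invertible g}"

definition torus :: "(complex^'n^'n) set" where
  "torus = {t \<in> GL. \<forall>i j. i \<noteq> j \<longrightarrow> t $ i $ j = 0}"

definition torus_coset :: "complex^'n^'n \<Rightarrow> (complex^'n^'n) set" where
  "torus_coset g = (\<lambda>t. g ** t) ` torus"

definition GL_mod_torus :: "(complex^'n^'n) set set" where
  "GL_mod_torus = torus_coset ` GL"

definition rank_one_projector :: "complex^'n^'n \<Rightarrow> bool" where
  "rank_one_projector P \<longleftrightarrow> P ** P = P \<and> rank P = 1"

definition complete_system :: "('n \<Rightarrow> complex^'n^'n) \<Rightarrow> bool" where
  "complete_system p \<longleftrightarrow>
     (\<forall>i. rank_one_projector (p i)) \<and> (\<forall>i j. i \<noteq> j \<longrightarrow> p i ** p j = 0)"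

definition coord_projector :: "'n \<Rightarrow> complex^'n^'n" where
  "coord_projector j = (\<chi> k l. if k = j \<and> l = j then 1 else 0)"

definition conj_system :: "complex^'n^'n \<Rightarrow> 'n \<Rightarrow> complex^'n^'n" where
  "conj_system g i = g ** coord_projector i ** matrix_inv g"

text \<open>The map induced by \<^term>\<open>conj_system\<close> on cosets; see \<open>coset_system_torus_coset\<close> below.\<close>

definition coset_system :: "(complex^'n^'n) set \<Rightarrow> 'n \<Rightarrow> complex^'n^'n" where
  "coset_system x = the_elem (conj_system ` x)"

lemma matrix_mult_matrix_inv:
  fixes g :: "complex^'n^'n"
  assumes "g \<in> GL"
  shows "g ** matrix_inv g = mat 1" "matrix_inv g ** g = mat 1"
  using assms someI_ex[of "\<lambda>h. g ** h = mat 1 \<and> h ** g = mat 1"]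
  by (auto simp: GL_def invertible_def matrix_inv_def)

lemma torus_commutes_coord_projector:
  assumes "t \<in> torus"
  shows "t ** coord_projector i = coord_projector i ** t"
proof -
  have "(t ** coord_projector i) $ k $ l = (coord_projector i ** t) $ k $ l" for k l
  proof -
    have "(t ** coord_projector i) $ k $ l = (\<Sum>m\<in>UNIV. if m = i then (if l = i then t $ k $ i else 0) else 0)"
      unfolding matrix_matrix_mult_def coord_projector_def vec_lambda_beta
      by (rule sum.cong) auto
    moreover have "(coord_projector i ** t) $ k $ l = (\<Sum>m\<in>UNIV. if m = i then (if k = i then t $ i $ l else 0) else 0)"
      unfolding matrix_matrix_mult_def coord_projector_def vec_lambda_beta
      by (rule sum.cong) auto
    ultimately show ?thesis
      using assms by (auto simp: torus_def)
  qed
  then show ?thesis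
    by (simp add: vec_eq_iff)
qed

lemma conj_system_mult_torus:
  assumes g: "g \<in> GL" and t: "t \<in> torus"
  shows "conj_system (g ** t) = conj_system g"
proof
  fix i
  let ?h = "g ** t"
  have tG: "t \<in> GL" and h: "?h \<in> GL"
    using g t by (auto simp: torus_def GL_def invertible_mult)
  have "conj_system ?h i ** ?h = g ** t ** coord_projector i"
    by (metis conj_system_def matrix_mul_assoc matrix_mul_rid matrix_mult_matrix_inv(2)[OF h])
  also have "\<dots> = conj_system g i ** ?h"
    by (metis conj_system_def torus_commutes_coord_projector[OF t] matrix_mul_assoc
        matrix_mul_rid matrix_mult_matrix_inv(2)[OF g])
  finally show "conj_system ?h i = conj_system g i"
    by (metis matrix_mul_assoc matrix_mul_rid matrix_mult_matrix_inv(1)[OF h])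
qed

lemma coset_system_torus_coset:
  assumes "g \<in> GL"
  shows "coset_system (torus_coset g) = conj_system g"
proof -
  have "mat 1 \<in> (torus :: (complex^'n^'n) set)"
    by (auto simp: torus_def GL_def mat_def[symmetric] invertible_def intro!: exI[of _ "mat 1"])
       (simp add: mat_def)
  then have "torus_coset g \<noteq> {}"
    by (auto simp: torus_coset_def)
  moreover have "conj_system h = conj_system g" if "h \<in> torus_coset g" for h
    using assms that by (auto simp: torus_coset_def conj_system_mult_torus)
  ultimately have "conj_system ` torus_coset g = {conj_system g}"
    by auto
  then show ?thesis
    by (simp add: coset_system_def)
qed

definition GL_nz :: "(complex^'n^'n) set" where
  "GL_nz = {g \<in> GL. \<forall>i j. g $ i $ j \<noteq> 0}"

text \<open>
  A branch of the multi-valued function on an open set is a single-valued function that near each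
  point is obtained by choosing continuous logarithms \<open>L\<close> of the matrix entries.
\<close>

definition expF_branch_on ::
    "complex^'n^'n \<Rightarrow> (complex^'n^'n) set \<Rightarrow> (complex^'n^'n \<Rightarrow> complex) \<Rightarrow> bool" where
  "expF_branch_on \<Lambda> U f \<longleftrightarrow> open U \<and> U \<subseteq> GL_nz \<and>
     (\<forall>g\<in>U. \<exists>W L. open W \<and> g \<in> W \<and> W \<subseteq> U \<and>
        (\<forall>i j. continuous_on W (L i j)) \<and>
        (\<forall>h\<in>W. (\<forall>i j. exp (L i j h) = h $ i $ j) \<and>
                f h = (\<Prod>i\<in>UNIV. \<Prod>j\<in>UNIV. exp (\<Lambda> $ j $ i * L i j h)) / det h))"

text \<open>
  A set \<open>V\<close> of cosets has preimage \<open>\<Union>V\<close> under the projection \<^term>\<open>torus_coset\<close>, so the condition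
  that \<open>\<Union>V\<close> be open, which is part of \<^term>\<open>expF_branch_on\<close>, says that \<open>V\<close> is open in the quotient
  topology. A branch on \<open>V\<close> is a function of cosets whose pullback is a branch.
\<close>

definition quotient_branch_on ::
    "complex^'n^'n \<Rightarrow> (complex^'n^'n) set set \<Rightarrow> ((complex^'n^'n) set \<Rightarrow> complex) \<Rightarrow> bool" where
  "quotient_branch_on \<Lambda> V \<phi> \<longleftrightarrow>
     V \<subseteq> GL_mod_torus \<and> expF_branch_on \<Lambda> (\<Union>V) (\<lambda>g. \<phi> (torus_coset g))"

text \<open>
  The manifold structure on the quotient is the one making \<^term>\<open>torus_coset\<close> a submersion, so the
  differential of \<open>\<phi>\<close> vanishes at a coset iff that of its pullback vanishes at the
  representatives. The pullbacks in question are holomorphic, hence the vanishing of the real and of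
  the complex differential amount to the same.
\<close>

definition quotient_differential_zero ::
    "((complex^'n^'n) set \<Rightarrow> complex) \<Rightarrow> (complex^'n^'n) set \<Rightarrow> bool" where
  "quotient_differential_zero \<phi> x \<longleftrightarrow>
     (\<forall>g\<in>x. ((\<lambda>h. \<phi> (torus_coset h)) has_derivative (\<lambda>_. 0)) (at g))"

text \<open>
  The existence of a branch is required explicitly, so that the condition on all branches cannot
  hold vacuously. It also restricts \<open>x\<close> to cosets of matrices with nonzero entries.
\<close>

definition critical_points :: "complex^'n^'n \<Rightarrow> (complex^'n^'n) set set" where
  "critical_points \<Lambda> = {x \<in> GL_mod_torus.
     (\<exists>V \<phi>. x \<in> V \<and> quotient_branch_on \<Lambda> V \<phi>) \<and>
     (\<forall>V \<phi>. x \<in> V \<and> quotient_branch_on \<Lambda> V \<phi> \<longrightarrow> quotient_differential_zero \<phi> x)}"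

end

theory Submission
  imports Defs
begin

text \<open>
  By Jacobi's formula, the coefficient of \<open>d g\<^sub>j\<^sub>i\<close> in \<open>dF\<close> is \<open>\<lambda>\<^sub>i\<^sub>j / g\<^sub>j\<^sub>i - (g\<^sup>-\<^sup>1)\<^sub>i\<^sub>j\<close>, while
  \<open>Tr (p\<^sub>i q\<^sub>j) = g\<^sub>j\<^sub>i (g\<^sup>-\<^sup>1)\<^sub>i\<^sub>j\<close> for \<open>p\<^sub>i = g q\<^sub>i g\<^sup>-\<^sup>1\<close>. Hence \<open>dF\<close> vanishes at \<open>g\<close> iff all the trace equations
  hold; these force the entries of \<open>g\<close> to be nonzero because the \<open>\<lambda>\<^sub>i\<^sub>j\<close> are. The cosets correspond
  bijectively to the complete systems: the nonzero projectors \<open>p\<^sub>i\<close> have fixed vectors \<open>v\<^sub>i\<close>, which are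
  the columns of a suitable \<open>g\<close>, and the centralizer of the coordinate projectors is the torus.
\<close>

section \<open>The derivative of the determinant\<close>

text \<open>The product rule differentiates each term of the Leibniz formula one factor at a time.
  Collecting the terms in which the factor from row \<open>i\<close> was differentiated gives the
  determinant with that row replaced.\<close>

lemma has_derivative_det_rows:
  fixes g :: "'a::real_normed_field^'n^'n"
  shows "(det has_derivative (\<lambda>k. \<Sum>i\<in>UNIV. det (\<chi> a. if a = i then k $ i else g $ a))) (at g)"
proof -
  let ?S = "{p. p permutes (UNIV :: 'n set)}"
  have nth: "((\<lambda>h. h $ i $ j) has_derivative (\<lambda>k. k $ i $ j)) (at g)" for i j
    by (intro bounded_linear_imp_has_derivative bounded_linear_compose[OF bounded_linear_vec_nth]
        bounded_linear_vec_nth)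
  have eq: "det (\<chi> a. if a = i then k $ i else g $ a) =
      (\<Sum>p\<in>?S. of_int (sign p) * (k $ i $ p i * (\<Prod>a\<in>UNIV - {i}. g $ a $ p a)))" for i k
    unfolding det_def
    by (intro sum.cong refl arg_cong2[of _ _ _ _ "(*)"])
       (subst prod.remove[of UNIV i], auto intro!: prod.cong)
  have "((\<lambda>h::'a^'n^'n. \<Sum>p\<in>?S. of_int (sign p) * (\<Prod>i\<in>UNIV. h $ i $ p i)) has_derivative
      (\<lambda>k. \<Sum>p\<in>?S. of_int (sign p) * (\<Sum>i\<in>UNIV. k $ i $ p i * (\<Prod>a\<in>UNIV - {i}. g $ a $ p a)))) (at g)"
    by (intro has_derivative_sum has_derivative_mult_right has_derivative_prod nth)
  moreover have "(\<Sum>p\<in>?S. of_int (sign p) * (\<Sum>i\<in>UNIV. k $ i $ p i * (\<Prod>a\<in>UNIV - {i}. g $ a $ p a))) =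
      (\<Sum>i\<in>UNIV. det (\<chi> a. if a = i then k $ i else g $ a))" for k
    unfolding eq sum_distrib_left by (rule sum.swap)
  ultimately show ?thesis
    by (simp add: det_def[abs_def])
qed

text \<open>Since \<open>k = (k ** B) ** g\<close>, row \<open>i\<close> of \<open>k\<close> is a
  combination of the rows of \<open>g\<close> with coefficients from row \<open>i\<close> of
  \<open>k ** B\<close>. By Cramer's rule only the coefficient of row \<open>i\<close> itself
  survives in the determinant.\<close>

lemma det_replace_row:
  fixes g :: "'a::field^'n^'n"
  assumes "B ** g = mat 1"
  shows "det (\<chi> a. if a = i then k $ i else g $ a) = (k ** B) $ i $ i * det g"
proof -
  have "(k ** B) ** g = k"
    by (simp add: assms flip: matrix_mul_assoc)
  moreover have "((k ** B) ** g) $ i $ j = (\<Sum>a\<in>UNIV. (k ** B) $ i $ a * g $ a $ j)" for j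
    unfolding matrix_matrix_mult_def[of _ g] by simp
  ultimately have "k $ i = (\<Sum>a\<in>UNIV. ((k ** B) $ i) $ a *s row a g)"
    by (simp add: vec_eq_iff row_def)
  then show ?thesis
    using cramer_lemma_transpose[of i "(k ** B) $ i" g] by (simp add: row_def cong: if_cong)
qed

text \<open>Jacobi's formula at an invertible matrix, with the inverse in place of the
  adjugate.\<close>

lemma has_derivative_det:
  fixes g :: "'a::real_normed_field^'n^'n"
  assumes "B ** g = mat 1"
  shows "(det has_derivative (\<lambda>k. trace (k ** B) * det g)) (at g)"
  using has_derivative_det_rows[of g]
  by (simp add: det_replace_row[OF assms] trace_def sum_distrib_right)

section \<open>Differentiating continuous logarithms\<close>

text \<open>Near \<open>x\<close>, continuity keeps \<open>L y - L x\<close> in the strip where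
  \<open>Ln\<close> inverts \<open>exp\<close>, so that \<open>L y = Ln (u y / u x) + L x\<close>.
  Dividing by \<open>u x\<close> means that \<open>Ln\<close> is differentiated only at 1, away from
  its cut.\<close>

lemma has_derivative_continuous_log:
  fixes u L :: "'a::real_normed_vector \<Rightarrow> complex"
  assumes W: "open W" "x \<in> W" and L: "continuous_on W L" "\<And>y. y \<in> W \<Longrightarrow> exp (L y) = u y"
    and u: "(u has_derivative u') (at x)"
  shows "(L has_derivative (\<lambda>k. u' k / u x)) (at x)"
proof -
  have ux: "u x \<noteq> 0"
    using L(2)[OF W(2)] by (metis exp_not_eq_zero)
  have "isCont L x"
    using L(1) W continuous_on_eq_continuous_at by blast
  then have "(L \<longlongrightarrow> L x) (nhds x)"
    by (simp add: isCont_def tendsto_nhds_iff)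
  then have "eventually (\<lambda>y. dist (L y) (L x) < pi) (nhds x)"
    by (rule tendstoD) simp
  moreover have "eventually (\<lambda>y. y \<in> W) (nhds x)"
    using W by (rule eventually_nhds_in_open)
  ultimately have ev: "eventually (\<lambda>y. Ln (u y / u x) + L x = L y) (nhds x)"
  proof eventually_elim
    case (elim y)
    have "\<bar>Im (L y - L x)\<bar> < pi"
      using elim(1) abs_Im_le_cmod[of "L y - L x"] by (simp add: dist_norm)
    then have "Ln (exp (L y - L x)) = L y - L x"
      by (intro Ln_exp) auto
    then show ?case
      using elim(2) W(2) by (simp add: exp_diff L(2))
  qed
  have "(Ln has_field_derivative 1) (at (u x / u x))"
    using has_field_derivative_Ln[of 1] ux by simp
  moreover have "((\<lambda>y. u y / u x) has_derivative (\<lambda>k. u' k / u x)) (at x)"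
    using bounded_linear.has_derivative[OF bounded_linear_divide u] .
  ultimately have "((\<lambda>y. Ln (u y / u x)) has_derivative (\<lambda>k. 1 * (u' k / u x))) (at x)"
    unfolding has_field_derivative_def by (rule has_derivative_compose[rotated])
  then have "((\<lambda>y. Ln (u y / u x) + L x) has_derivative (\<lambda>k. u' k / u x)) (at x)"
    by (auto intro!: derivative_eq_intros)
  then show ?thesis
    by (rule has_derivative_transform_eventually)
       (use ev in \<open>simp_all add: eventually_nhds_conv_at\<close>)
qed

section \<open>The differential of a branch and the trace equations\<close>

text \<open>The projector is the outer product of column \<open>i\<close> of \<open>g\<close> and
  row \<open>i\<close> of its inverse; both its traces and its rank are read off from this
  shape.\<close>

lemma conj_system_nth: "conj_system g i $ k $ l = g $ k $ i * matrix_inv g $ i $ l"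
proof -
  have "(g ** coord_projector i) $ k $ m = (if m = i then g $ k $ i else 0)" for m
  proof -
    have "(g ** coord_projector i) $ k $ m = (\<Sum>a\<in>UNIV. if a = i then (if m = i then g $ k $ i else 0) else 0)"
      unfolding matrix_matrix_mult_def coord_projector_def vec_lambda_beta
      by (rule sum.cong) auto
    then show ?thesis by simp
  qed
  then have "conj_system g i $ k $ l = (\<Sum>m\<in>UNIV. if m = i then g $ k $ i * matrix_inv g $ i $ l else 0)"
    unfolding conj_system_def matrix_matrix_mult_def[of "g ** coord_projector i"] vec_lambda_beta
    by (intro sum.cong) auto
  then show ?thesis by simp
qed

lemma trace_mult_coord_projector: "trace (A ** coord_projector j) = A $ j $ j"
proof -
  have "(A ** coord_projector j) $ m $ m = (\<Sum>a\<in>UNIV. if a = j then (if m = j then A $ j $ j else 0) else 0)" for m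
    unfolding matrix_matrix_mult_def coord_projector_def vec_lambda_beta
    by (rule sum.cong) auto
  then have "(A ** coord_projector j) $ m $ m = (if m = j then A $ j $ j else 0)" for m
    by simp
  then show ?thesis by (simp add: trace_def)
qed

text \<open>Locally \<open>f\<close> is \<open>exp S / det\<close>, where \<open>S\<close> is a
  linear combination of the logarithms. Its logarithmic differential is therefore that of
  \<open>S\<close> minus Jacobi's trace, which is then expanded in the entries of the direction
  \<open>k\<close>.\<close>

lemma has_derivative_expF_branch:
  assumes U: "expF_branch_on \<Lambda> U f" and g: "g \<in> U"
  shows "f g \<noteq> 0"
    and "(f has_derivative (\<lambda>k. f g * (\<Sum>i\<in>UNIV. \<Sum>j\<in>UNIV.
            (\<Lambda> $ j $ i / g $ i $ j - matrix_inv g $ j $ i) * k $ i $ j))) (at g)"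
proof -
  have "\<exists>W L. open W \<and> g \<in> W \<and> W \<subseteq> U \<and> (\<forall>i j. continuous_on W (L i j)) \<and>
        (\<forall>h\<in>W. (\<forall>i j. exp (L i j h) = h $ i $ j) \<and>
                f h = (\<Prod>i\<in>UNIV. \<Prod>j\<in>UNIV. exp (\<Lambda> $ j $ i * L i j h)) / det h)"
    using U unfolding expF_branch_on_def by (elim conjE) (erule bspec[OF _ g])
  then obtain W L where W: "open W" "g \<in> W"
    and L: "\<And>i j. continuous_on W (L i j)" "\<And>h i j. h \<in> W \<Longrightarrow> exp (L i j h) = h $ i $ j"
    and f: "\<And>h. h \<in> W \<Longrightarrow> f h = (\<Prod>i\<in>UNIV. \<Prod>j\<in>UNIV. exp (\<Lambda> $ j $ i * L i j h)) / det h"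
    by (elim exE conjE) (simp only: Ball_def, fast)
  have gG: "g \<in> GL"
    using U g unfolding expF_branch_on_def GL_nz_def by auto
  then have det: "det g \<noteq> 0"
    by (simp add: GL_def invertible_det_nz)
  then show "f g \<noteq> 0"
    by (simp add: f[OF W(2)])
  define S where "S h = (\<Sum>i\<in>UNIV. \<Sum>j\<in>UNIV. \<Lambda> $ j $ i * L i j h)" for h
  have f: "f h = exp (S h) / det h" if "h \<in> W" for h
    by (simp add: f[OF that] S_def exp_sum)
  have nth: "((\<lambda>h. h $ i $ j) has_derivative (\<lambda>k. k $ i $ j)) (at g)" for i j
    by (intro bounded_linear_imp_has_derivative bounded_linear_compose[OF bounded_linear_vec_nth]
        bounded_linear_vec_nth)
  have L': "(L i j has_derivative (\<lambda>k. k $ i $ j / g $ i $ j)) (at g)" for i j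
    using has_derivative_continuous_log[OF W(1,2) L(1)[of i j], of "\<lambda>h. h $ i $ j"] L(2) nth by blast
  then have S: "(S has_derivative (\<lambda>k. \<Sum>i\<in>UNIV. \<Sum>j\<in>UNIV. \<Lambda> $ j $ i * (k $ i $ j / g $ i $ j))) (at g)"
    unfolding S_def by (intro has_derivative_sum has_derivative_mult_right L')
  let ?S' = "\<lambda>k. \<Sum>i\<in>UNIV. \<Sum>j\<in>UNIV. \<Lambda> $ j $ i * (k $ i $ j / g $ i $ j)"
  let ?tr = "\<lambda>k. trace (k ** matrix_inv g)"
  have E: "((\<lambda>h. exp (S h)) has_derivative (\<lambda>k. exp (S g) * ?S' k)) (at g)"
    using has_derivative_compose[OF S, of exp "(*) (exp (S g))"] DERIV_exp[of "S g"]
    by (simp add: has_field_derivative_def)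
  have D: "(det has_derivative (\<lambda>k. ?tr k * det g)) (at g)"
    by (rule has_derivative_det[OF matrix_mult_matrix_inv(2)[OF gG]])
  have "((\<lambda>h. exp (S h) / det h) has_derivative (\<lambda>k. f g * (?S' k - ?tr k))) (at g)"
    by (rule has_derivative_eq_rhs[OF has_derivative_divide'[OF E D det]])
       (simp add: fun_eq_iff f[OF W(2)] det divide_simps, simp add: algebra_simps)
  then have "(f has_derivative (\<lambda>k. f g * (?S' k - ?tr k))) (at g)"
    by (rule has_derivative_transform_within_open[OF _ W(1,2)]) (simp add: f)
  moreover have "(\<lambda>k. f g * (?S' k - ?tr k)) = (\<lambda>k. f g * (\<Sum>i\<in>UNIV. \<Sum>j\<in>UNIV.
            (\<Lambda> $ j $ i / g $ i $ j - matrix_inv g $ j $ i) * k $ i $ j))"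
    by (simp add: trace_def matrix_matrix_mult_def right_diff_distrib sum_subtractf mult.commute)
  ultimately show "(f has_derivative (\<lambda>k. f g * (\<Sum>i\<in>UNIV. \<Sum>j\<in>UNIV.
            (\<Lambda> $ j $ i / g $ i $ j - matrix_inv g $ j $ i) * k $ i $ j))) (at g)"
    by (simp only:)
qed

text \<open>As \<open>f g\<close> is nonzero, the differential vanishes iff all coefficients of the
  linear form do. Multiplying a coefficient by the nonzero entry of \<open>g\<close> turns its
  vanishing into a trace equation.\<close>

lemma expF_branch_differential_zero_iff:
  assumes U: "expF_branch_on \<Lambda> U f" and g: "g \<in> U"
  shows "(f has_derivative (\<lambda>_. 0)) (at g) \<longleftrightarrow>
           (\<forall>i j. trace (conj_system g i ** coord_projector j) = \<Lambda> $ i $ j)"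
proof -
  let ?c = "\<lambda>i j. \<Lambda> $ j $ i / g $ i $ j - matrix_inv g $ j $ i"
  let ?D = "\<lambda>k::complex^'a^'a. f g * (\<Sum>i\<in>UNIV. \<Sum>j\<in>UNIV. ?c i j * k $ i $ j)"
  note D = has_derivative_expF_branch[OF U g]
  have nz: "g $ i $ j \<noteq> 0" for i j
    using U g unfolding expF_branch_on_def GL_nz_def by auto
  have "(f has_derivative (\<lambda>_. 0)) (at g) \<longleftrightarrow> ?D = (\<lambda>_. 0)"
  proof
    assume "(f has_derivative (\<lambda>_. 0)) (at g)"
    with D(2) show "?D = (\<lambda>_. 0)"
      by (rule has_derivative_unique)
  next
    assume "?D = (\<lambda>_. 0)"
    with D(2) show "(f has_derivative (\<lambda>_. 0)) (at g)"
      by simp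
  qed
  also have "\<dots> \<longleftrightarrow> (\<forall>i j. ?c i j = 0)"
  proof
    assume 0: "?D = (\<lambda>_. 0)"
    have "?c a b = 0" for a b
    proof -
      \<comment> \<open>The matrix unit at \<open>(a, b)\<close> is the direction that isolates a
        single coefficient.\<close>
      define k :: "complex^'a^'a" where "k = (\<chi> i j. if i = a then if j = b then 1 else 0 else 0)"
      have "(\<Sum>j\<in>UNIV. ?c i j * k $ i $ j) = (if i = a then ?c a b else 0)" for i
      proof -
        have "(\<Sum>j\<in>UNIV. ?c i j * k $ i $ j) = (\<Sum>j\<in>UNIV. if j = b then if i = a then ?c a b else 0 else 0)"
          by (intro sum.cong) (auto simp: k_def)
        then show ?thesis by simp
      qed
      then have "(\<Sum>i\<in>UNIV. \<Sum>j\<in>UNIV. ?c i j * k $ i $ j) = ?c a b"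
        by simp
      then show ?thesis
        using fun_cong[OF 0, of k] D(1) by simp
    qed
    then show "\<forall>i j. ?c i j = 0" by blast
  qed simp
  also have "\<dots> \<longleftrightarrow> (\<forall>i j. trace (conj_system g i ** coord_projector j) = \<Lambda> $ i $ j)"
  proof -
    \<comment> \<open>The coefficient at entry \<open>(i, j)\<close> belongs to the trace equation
      with the indices swapped.\<close>
    have "?c i j = 0 \<longleftrightarrow> trace (conj_system g j ** coord_projector i) = \<Lambda> $ j $ i" for i j
      using nz by (auto simp: trace_mult_coord_projector conj_system_nth divide_simps mult.commute)
    then show ?thesis by blast
  qed
  finally show ?thesis .
qed

section \<open>The torus and its cosets\<close>

lemma mat_1_in_torus: "mat 1 \<in> torus"
  by (auto simp: torus_def GL_def invertible_def mat_def[symmetric] intro!: exI[of _ "mat 1"])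
     (simp add: mat_def)

lemma in_torus_coset: "g \<in> torus_coset g"
  unfolding torus_coset_def by (rule image_eqI[OF _ mat_1_in_torus]) simp

lemma mult_torus_nth:
  assumes "t \<in> torus"
  shows "(g ** t) $ i $ j = g $ i $ j * t $ j $ j"
proof -
  have "(g ** t) $ i $ j = (\<Sum>a\<in>UNIV. if a = j then g $ i $ j * t $ j $ j else 0)"
    unfolding matrix_matrix_mult_def vec_lambda_beta
    using assms by (intro sum.cong) (auto simp: torus_def)
  then show ?thesis by simp
qed

lemma det_torus: "t \<in> torus \<Longrightarrow> det t = (\<Prod>i\<in>UNIV. t $ i $ i)"
  by (rule det_diagonal) (auto simp: torus_def)

lemma torus_diag_nonzero:
  assumes "t \<in> torus"
  shows "t $ i $ i \<noteq> 0"
proof -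
  have "det t \<noteq> 0"
    using assms by (simp add: torus_def GL_def invertible_det_nz)
  then show ?thesis
    by (auto simp: det_torus[OF assms])
qed

lemma mult_torus_in_GL: "g \<in> GL \<Longrightarrow> t \<in> torus \<Longrightarrow> g ** t \<in> GL"
  by (auto simp: torus_def GL_def invertible_mult)

lemma mult_torus_in_GL_nz: "g \<in> GL_nz \<Longrightarrow> t \<in> torus \<Longrightarrow> g ** t \<in> GL_nz"
  by (auto simp: GL_nz_def mult_torus_in_GL mult_torus_nth torus_diag_nonzero)

lemma torus_mult:
  assumes s: "s \<in> torus" and t: "t \<in> torus"
  shows "s ** t \<in> torus"
proof -
  have "s ** t \<in> GL"
    using s by (intro mult_torus_in_GL t) (simp add: torus_def)
  moreover have "(s ** t) $ i $ j = 0" if "i \<noteq> j" for i j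
    using s that by (simp add: mult_torus_nth[OF t]) (simp add: torus_def)
  ultimately show ?thesis
    by (simp add: torus_def)
qed

lemma torus_inv:
  assumes t: "t \<in> torus"
  shows "(\<chi> i j. if i = j then inverse (t $ i $ i) else 0) \<in> torus"
    (is "?s \<in> _") "t ** (\<chi> i j. if i = j then inverse (t $ i $ i) else 0) = mat 1"
proof -
  have "(t ** ?s) $ i $ j = (\<Sum>a\<in>UNIV. if a = j then if i = j then 1 else 0 else 0)" for i j
    unfolding matrix_matrix_mult_def vec_lambda_beta
    using t torus_diag_nonzero[OF t] by (intro sum.cong) (auto simp: torus_def)
  then show "t ** ?s = mat 1"
    by (simp add: vec_eq_iff mat_def)
  \<comment> \<open>For square matrices the left inverse \<open>t\<close> suffices for
    invertibility.\<close>
  then have "?s \<in> GL"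
    using invertible_left_inverse[of ?s] by (auto simp: GL_def)
  then show "?s \<in> torus"
    by (simp add: torus_def)
qed

lemma torus_coset_mult:
  assumes t: "t \<in> torus"
  shows "torus_coset (g ** t) = torus_coset g"
proof
  have sub: "torus_coset (h ** u) \<subseteq> torus_coset h" if "u \<in> torus" for h u :: "complex^'n^'n"
    using torus_mult[OF that] by (auto simp: torus_coset_def simp flip: matrix_mul_assoc)
  show "torus_coset (g ** t) \<subseteq> torus_coset g"
    using t by (rule sub)
  \<comment> \<open>The reverse inclusion is the first one applied to \<open>g ** t\<close> and the
    inverse of \<open>t\<close>.\<close>
  obtain s where s: "s \<in> torus" "t ** s = mat 1"
    using torus_inv[OF t] by blast
  then show "torus_coset g \<subseteq> torus_coset (g ** t)"
    using sub[of s "g ** t"] by (simp flip: matrix_mul_assoc)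
qed

section \<open>Existence of a branch on the quotient\<close>

lemma continuous_on_matrix_entry:
  "continuous_on S (\<lambda>h::'a::topological_space^'m^'n. h $ i $ j)"
  by (intro continuous_intros)

lemma open_GL_nz: "open (GL_nz :: (complex^'n^'n) set)"
proof -
  have eq: "GL_nz = {h::complex^'n^'n. det h \<noteq> 0} \<inter> (\<Inter>i. \<Inter>j. {h. h $ i $ j \<noteq> 0})"
    by (auto simp: GL_nz_def GL_def invertible_det_nz)
  have "continuous_on UNIV (det :: complex^'n^'n \<Rightarrow> complex)"
    unfolding det_def[abs_def] by (intro continuous_intros)
  then show ?thesis
    unfolding eq by (intro open_Int open_INT finite ballI open_Collect_neq continuous_intros)
qed

text \<open>This set is where all \<open>q k\<close> avoid the cut of \<open>Ln\<close>, so that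
  their principal logarithms are continuous. It is a finite intersection of open preimages.\<close>

lemma open_not_nonpos_Reals:
  fixes q :: "'k::finite \<Rightarrow> 'a::topological_space \<Rightarrow> complex"
  assumes "open S" "\<And>k. continuous_on S (q k)"
  shows "open {h \<in> S. \<forall>k. q k h \<notin> \<real>\<^sub>\<le>\<^sub>0}"
proof -
  have eq: "{h \<in> S. \<forall>k. q k h \<notin> \<real>\<^sub>\<le>\<^sub>0} = (\<Inter>k. S \<inter> q k -` (- \<real>\<^sub>\<le>\<^sub>0))"
    by auto
  show ?thesis
    unfolding eq using assms
    by (intro open_INT ballI continuous_open_preimage) (auto simp: closed_nonpos_Reals_complex)
qed

text \<open>
  A torus-invariant branch is built from logarithms of the column-normalized entries \<open>h\<^sub>i\<^sub>j / h\<^sub>m\<^sub>j\<close>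
  relative to those of \<open>g\<close>. Since the rows of \<open>\<Lambda>\<close> sum to 1, undoing the normalization contributes
  exactly the single-valued factor \<open>\<Prod>\<^sub>j h\<^sub>m\<^sub>j\<close>.
\<close>

lemma quotient_branch_exists:
  fixes g \<Lambda> :: "complex^'n^'n"
  assumes g: "g \<in> GL_nz" and \<Lambda>: "\<And>i. (\<Sum>j\<in>UNIV. \<Lambda> $ i $ j) = 1"
  shows "\<exists>V \<phi>. torus_coset g \<in> V \<and> quotient_branch_on \<Lambda> V \<phi>"
proof -
  \<comment> \<open>An arbitrary row serves as reference for normalizing the columns.\<close>
  fix m :: 'n
  \<comment> \<open>Both entries in \<open>h $ i $ j / h $ m $ j\<close> are scaled alike by the
    torus, so \<open>r\<close> is invariant. Dividing by the value at \<open>g\<close> makes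
    \<open>r g\<close> equal to 1, which puts \<open>g\<close> into \<open>U\<close> below.\<close>
  define r where "r h i j = (h $ i $ j / h $ m $ j) / (g $ i $ j / g $ m $ j)" for h :: "complex^'n^'n" and i j
  \<comment> \<open>This constant undoes the division by the value at \<open>g\<close>:
    \<open>exp (Ln (r h i j) + c i j)\<close> is \<open>h $ i $ j / h $ m $ j\<close>.\<close>
  define c where "c i j = Ln (g $ i $ j / g $ m $ j)" for i j
  define U where "U = {h \<in> GL_nz. \<forall>k. r h (fst k) (snd k) \<notin> \<real>\<^sub>\<le>\<^sub>0}"
  define f where "f h = (\<Prod>i\<in>UNIV. \<Prod>j\<in>UNIV. exp (\<Lambda> $ j $ i * (Ln (r h i j) + c i j))) *
      (\<Prod>j\<in>UNIV. h $ m $ j) / det h" for h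
  have gnz: "g $ i $ j \<noteq> 0" for i j
    using g by (simp add: GL_nz_def)
  have rc: "continuous_on S (\<lambda>h. r h i j)" if "S \<subseteq> GL_nz" for S i j
    unfolding r_def using that gnz
    by (intro continuous_intros continuous_on_matrix_entry) (auto simp: GL_nz_def)
  have U_open: "open U"
    unfolding U_def by (intro open_not_nonpos_Reals[where q="\<lambda>k h. r h (fst k) (snd k)"] open_GL_nz rc) simp
  have U_nz: "U \<subseteq> GL_nz"
    by (auto simp: U_def)
  have r_torus: "r (h ** t) = r h" if "t \<in> torus" for h t
    using torus_diag_nonzero[OF that] by (simp add: r_def fun_eq_iff mult_torus_nth[OF that])
  have U_torus: "h ** t \<in> U" if "h \<in> U" "t \<in> torus" for h t
    using that by (auto simp: U_def r_torus mult_torus_in_GL_nz)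
  \<comment> \<open>The product of the row-\<open>m\<close> entries and the determinant are both
    multiplied by \<open>det t\<close>, which cancels in the quotient.\<close>
  have f_torus: "f (h ** t) = f h" if "t \<in> torus" for h t
    using torus_diag_nonzero[OF that]
    by (simp add: f_def r_torus[OF that] mult_torus_nth[OF that] det_mul det_torus[OF that] prod.distrib)
  define V where "V = torus_coset ` U"
  \<comment> \<open>As \<open>f\<close> is constant on cosets, its image of a coset is a
    singleton.\<close>
  define \<phi> where "\<phi> x = the_elem (f ` x)" for x
  have UV: "\<Union>V = U"
  proof
    show "\<Union>V \<subseteq> U"
      using U_torus by (auto simp: V_def torus_coset_def)
    show "U \<subseteq> \<Union>V"
      using in_torus_coset by (auto simp: V_def)
  qed
  have \<phi>: "\<phi> (torus_coset h) = f h" for h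
  proof -
    have "f ` torus_coset h = {f h}"
      using in_torus_coset[of h] by (auto simp: torus_coset_def f_torus)
    then show ?thesis by (simp add: \<phi>_def)
  qed
  have "expF_branch_on \<Lambda> U f"
    unfolding expF_branch_on_def
  proof (intro conjI ballI U_open U_nz)
    fix h0 assume h0: "h0 \<in> U"
    then have h0nz: "h0 $ i $ j \<noteq> 0" for i j
      by (simp add: U_def GL_nz_def)
    \<comment> \<open>The row-\<open>m\<close> entries have continuous logarithms only locally,
      since on a whole coset they wind around 0. The set \<open>W\<close> around \<open>h0\<close>
      may fail to be torus-invariant, because the definition of a branch asks for logarithms only
      near each point.\<close>
    define W where "W = {h \<in> U. \<forall>j. h $ m $ j / h0 $ m $ j \<notin> \<real>\<^sub>\<le>\<^sub>0}"
    define l where "l j h = Ln (h $ m $ j / h0 $ m $ j) + Ln (h0 $ m $ j)" for j h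
    define L where "L i j h = Ln (r h i j) + c i j + l j h" for i j h
    have "open W"
      unfolding W_def using h0nz
      by (intro open_not_nonpos_Reals U_open continuous_intros continuous_on_matrix_entry) simp
    moreover have "h0 \<in> W"
      using h0 h0nz by (simp add: W_def)
    moreover have "W \<subseteq> U"
      by (auto simp: W_def)
    moreover have "continuous_on W (L i j)" for i j
      unfolding L_def l_def
      using h0nz \<open>W \<subseteq> U\<close> U_nz
      by (intro continuous_intros continuous_on_matrix_entry rc) (auto simp: W_def U_def)
    moreover have "exp (L i j h) = h $ i $ j" and l: "exp (l j h) = h $ m $ j" if "h \<in> W" for i j h
    proof -
      have "h $ a $ b \<noteq> 0" for a b
        using that by (simp add: W_def U_def GL_nz_def)
      then show "exp (l j h) = h $ m $ j" "exp (L i j h) = h $ i $ j"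
        using h0nz gnz by (simp_all add: L_def l_def c_def r_def exp_add)
    qed
    moreover have "f h = (\<Prod>i\<in>UNIV. \<Prod>j\<in>UNIV. exp (\<Lambda> $ j $ i * L i j h)) / det h" if "h \<in> W" for h
    proof -
      have "(\<Prod>i\<in>UNIV. \<Prod>j\<in>UNIV. exp (\<Lambda> $ j $ i * l j h)) = (\<Prod>j\<in>UNIV. exp ((\<Sum>i\<in>UNIV. \<Lambda> $ j $ i) * l j h))"
        by (subst prod.swap) (simp add: exp_sum sum_distrib_right)
      also have "\<dots> = (\<Prod>j\<in>UNIV. h $ m $ j)"
        by (simp add: \<Lambda> l[OF that])
      finally show ?thesis
        by (simp add: f_def L_def ring_distribs exp_add prod.distrib)
    qed
    ultimately show "\<exists>W L. open W \<and> h0 \<in> W \<and> W \<subseteq> U \<and>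
        (\<forall>i j. continuous_on W (L i j)) \<and>
        (\<forall>h\<in>W. (\<forall>i j. exp (L i j h) = h $ i $ j) \<and>
                f h = (\<Prod>i\<in>UNIV. \<Prod>j\<in>UNIV. exp (\<Lambda> $ j $ i * L i j h)) / det h)"
      by (intro exI[of _ W] exI[of _ L] conjI ballI allI)
  qed
  then have "quotient_branch_on \<Lambda> V \<phi>"
    using U_nz unfolding quotient_branch_on_def UV \<phi>
    by (auto simp: V_def GL_mod_torus_def GL_nz_def)
  moreover have "torus_coset g \<in> V"
    using g gnz by (auto simp: V_def U_def r_def)
  ultimately show ?thesis by blast
qed

section \<open>Critical points and the trace equations\<close>

text \<open>For every branch around a coset, the vanishing of the differential amounts to the same
  trace equations. The branch provided by the definition gives one inclusion; for the other, the
  constructed branch supplies the existence clause.\<close>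

lemma critical_points_eq:
  fixes \<Lambda> :: "complex^'n^'n"
  assumes "\<And>i j. \<Lambda> $ i $ j \<noteq> 0"
    and "\<And>i. (\<Sum>j\<in>UNIV. \<Lambda> $ i $ j) = 1"
  shows "critical_points \<Lambda> =
           {x \<in> GL_mod_torus. \<forall>i j. trace (coset_system x i ** coord_projector j) = \<Lambda> $ i $ j}"
proof -
  have zero_iff: "quotient_differential_zero \<phi> (torus_coset g) \<longleftrightarrow>
      (\<forall>i j. trace (conj_system g i ** coord_projector j) = \<Lambda> $ i $ j)"
    if g: "g \<in> GL" and V: "torus_coset g \<in> V" "quotient_branch_on \<Lambda> V \<phi>" for g V \<phi>
  proof -
    have br: "expF_branch_on \<Lambda> (\<Union>V) (\<lambda>h. \<phi> (torus_coset h))"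
      using V(2) by (simp add: quotient_branch_on_def)
    \<comment> \<open>Hence the condition is the same at all representatives of the coset.\<close>
    have "conj_system h = conj_system g" if "h \<in> torus_coset g" for h
      using g that by (auto simp: torus_coset_def conj_system_mult_torus)
    moreover have "h \<in> \<Union>V" if "h \<in> torus_coset g" for h
      using V(1) that by blast
    ultimately have "((\<lambda>h. \<phi> (torus_coset h)) has_derivative (\<lambda>_. 0)) (at h) \<longleftrightarrow>
        (\<forall>i j. trace (conj_system g i ** coord_projector j) = \<Lambda> $ i $ j)" if "h \<in> torus_coset g" for h
      using that by (simp only: expF_branch_differential_zero_iff[OF br])
    then show ?thesis
      using in_torus_coset[of g] unfolding quotient_differential_zero_def by blast
  qed
  have "torus_coset g \<in> critical_points \<Lambda> \<longleftrightarrow>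
      (\<forall>i j. trace (conj_system g i ** coord_projector j) = \<Lambda> $ i $ j)" if g: "g \<in> GL" for g
  proof
    assume "torus_coset g \<in> critical_points \<Lambda>"
    then show "\<forall>i j. trace (conj_system g i ** coord_projector j) = \<Lambda> $ i $ j"
    proof -
      obtain V \<phi> where V: "torus_coset g \<in> V" "quotient_branch_on \<Lambda> V \<phi>"
          "quotient_differential_zero \<phi> (torus_coset g)"
        using \<open>torus_coset g \<in> critical_points \<Lambda>\<close> by (auto simp: critical_points_def)
      then show ?thesis
        using zero_iff[OF g V(1,2)] by simp
    qed
  next
    assume tr: "\<forall>i j. trace (conj_system g i ** coord_projector j) = \<Lambda> $ i $ j"
    \<comment> \<open>Nonzero entries are what the construction of a branch requires: if
      \<open>g $ j $ i\<close> were 0, so would be the trace for \<open>i\<close> and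
      \<open>j\<close>.\<close>
    then have "g \<in> GL_nz"
      using g assms(1) by (simp add: GL_nz_def trace_mult_coord_projector conj_system_nth) (metis mult_zero_left)
    then show "torus_coset g \<in> critical_points \<Lambda>"
      using quotient_branch_exists[of g \<Lambda>] assms(2) g zero_iff[OF g] tr
      unfolding critical_points_def GL_mod_torus_def by blast
  qed
  moreover have "critical_points \<Lambda> \<subseteq> GL_mod_torus"
    by (auto simp: critical_points_def)
  ultimately show ?thesis
    by (auto simp: GL_mod_torus_def coset_system_torus_coset)
qed

section \<open>Complete systems as conjugates of the coordinate projectors\<close>

text \<open>All rows are multiples of \<open>w\<close> and at least one is a nonzero multiple, so
  the row space is the line spanned by \<open>w\<close>.\<close>

lemma rank_eq_1_outer_product:
  fixes A :: "'a::field^'n^'m"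
  assumes A: "\<And>k l. A $ k $ l = v $ k * w $ l" and "v \<noteq> 0" "w \<noteq> 0"
  shows "rank A = 1"
proof -
  have row: "row k A = v $ k *s w" for k
    by (simp add: vec_eq_iff row_def A)
  obtain k where "v $ k \<noteq> 0"
    using \<open>v \<noteq> 0\<close> by (auto simp: vec_eq_iff)
  then have "w = inverse (v $ k) *s row k A"
    by (simp add: row vec_eq_iff)
  moreover have "row k A \<in> vec.span (rows A)"
    by (rule vec.span_base) (auto simp: rows_def)
  ultimately have "w \<in> vec.span (rows A)"
    using vec.span_scale by metis
  moreover have "rows A \<subseteq> vec.span {w}"
    by (auto simp: rows_def row vec.span_base vec.span_scale)
  ultimately have "vec.span (rows A) = vec.span {w}"
    by (simp add: vec.span_eq)
  then have "vec.dim (rows A) = vec.dim {w}"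
    using vec.dim_span[of "rows A"] vec.dim_span[of "{w}"] by simp
  then show ?thesis
    using \<open>w \<noteq> 0\<close> by (simp add: row_rank_def_gen)
qed

lemma coord_projector_mult:
  "coord_projector i ** coord_projector j = (if i = j then coord_projector i else 0)"
proof -
  have "(coord_projector i ** coord_projector j) $ k $ l =
     (\<Sum>a\<in>UNIV. if a = i then if i = j \<and> k = i \<and> l = i then 1 else 0 else 0)" for k l
    unfolding matrix_matrix_mult_def coord_projector_def vec_lambda_beta
    by (intro sum.cong) auto
  then show ?thesis
    by (auto simp: vec_eq_iff coord_projector_def)
qed

lemma complete_system_conj_system:
  assumes g: "g \<in> GL"
  shows "complete_system (conj_system g)"
proof -
  note inv = matrix_mult_matrix_inv[OF g]
  have mult: "conj_system g i ** conj_system g j = g ** (coord_projector i ** coord_projector j) ** matrix_inv g" for i j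
  proof -
    have "conj_system g i ** conj_system g j =
        g ** coord_projector i ** (matrix_inv g ** g) ** coord_projector j ** matrix_inv g"
      by (simp add: conj_system_def matrix_mul_assoc)
    then show ?thesis
      by (simp add: inv matrix_mul_assoc)
  qed
  have "rank (conj_system g i) = 1" for i
  proof (rule rank_eq_1_outer_product[where v="column i g" and w="row i (matrix_inv g)"])
    \<comment> \<open>The two vectors of the outer product pair to 1, so neither is zero.\<close>
    have "(matrix_inv g ** g) $ i $ i = 1"
      by (simp add: inv mat_def)
    then have 1: "(\<Sum>k\<in>UNIV. matrix_inv g $ i $ k * g $ k $ i) = 1"
      by (simp add: matrix_matrix_mult_def)
    show "column i g \<noteq> 0" "row i (matrix_inv g) \<noteq> 0"
      by (rule ccontr; use 1 in \<open>simp add: vec_eq_iff column_def row_def\<close>)+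
  qed (simp add: conj_system_nth column_def row_def)
  moreover have "conj_system g i ** conj_system g i = conj_system g i" for i
    unfolding mult by (simp add: coord_projector_mult conj_system_def)
  moreover have "conj_system g i ** conj_system g j = 0" if "i \<noteq> j" for i j
    unfolding mult using that by (simp add: coord_projector_mult)
  ultimately show ?thesis
    by (simp add: complete_system_def rank_one_projector_def)
qed

text \<open>Trades the inverse of \<open>g\<close> for an intertwining relation, which can be
  checked column by column.\<close>

lemma conj_system_eq_iff:
  assumes g: "g \<in> GL"
  shows "conj_system g i = P \<longleftrightarrow> P ** g = g ** coord_projector i"
proof
  assume "conj_system g i = P"
  then show "P ** g = g ** coord_projector i"
    by (auto simp: conj_system_def matrix_mult_matrix_inv[OF g] simp flip: matrix_mul_assoc)
next
  assume "P ** g = g ** coord_projector i"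
  then have "conj_system g i = P ** g ** matrix_inv g"
    by (simp add: conj_system_def)
  then show "conj_system g i = P"
    by (simp add: matrix_mult_matrix_inv[OF g] flip: matrix_mul_assoc)
qed

lemma complete_system_imp_conj_system:
  fixes p :: "'n \<Rightarrow> complex^'n^'n"
  assumes p: "complete_system p"
  shows "\<exists>g\<in>GL. conj_system g = p"
proof -
  have idem: "p i ** p i = p i" and orth: "i \<noteq> j \<Longrightarrow> p i ** p j = 0" and rank: "rank (p i) = 1" for i j
    using p by (auto simp: complete_system_def rank_one_projector_def)
  \<comment> \<open>Rank 1 makes \<open>p i\<close> nonzero, and by idempotence \<open>p i\<close>
    fixes every vector in its range.\<close>
  have "\<exists>v. v \<noteq> 0 \<and> p i *v v = v" for i
  proof -
    have "p i \<noteq> 0"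
    proof
      assume "p i = 0"
      then have "rows (p i) \<subseteq> {0}"
        by (auto simp: rows_def row_def vec_eq_iff)
      then have "rank (p i) = 0"
        by (simp add: row_rank_def_gen)
      then show False
        using rank[of i] by simp
    qed
    then obtain x where "p i *v x \<noteq> 0"
      by (auto simp: matrix_eq)
    moreover have "p i *v (p i *v x) = p i *v x"
      by (simp add: matrix_vector_mul_assoc idem)
    ultimately show ?thesis
      by blast
  qed
  then obtain v where v: "\<And>i. v i \<noteq> 0" "\<And>i. p i *v v i = v i"
    by metis
  have v0: "p i *v v j = 0" if "i \<noteq> j" for i j
    using matrix_vector_mul_assoc[of "p i" "p j" "v j"] by (simp add: orth[OF that] v(2))
  define g :: "complex^'n^'n" where "g = (\<chi> k j. v j $ k)"
  have col: "column j g = v j" for j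
    by (simp add: g_def column_def vec_eq_iff)
  have "c j = 0" if c: "(\<Sum>i\<in>UNIV. c i *s column i g) = 0" for c j
  proof -
    \<comment> \<open>Applying \<open>p j\<close> to the linear relation kills every term except the
      one with index \<open>j\<close>.\<close>
    have "0 = p j *v (\<Sum>i\<in>UNIV. c i *s v i)"
      using c by (simp add: col)
    also have "\<dots> = (\<Sum>i\<in>UNIV. c i *s (p j *v v i))"
      by (simp add: vec.sum vec.scale)
    also have "\<dots> = (\<Sum>i\<in>UNIV. if i = j then c j *s v j else 0)"
      by (intro sum.cong) (auto simp: v v0)
    finally show ?thesis
      using v(1)[of j] by simp
  qed
  then have g: "g \<in> GL"
    using matrix_left_invertible_independent_columns[of g]
    by (auto simp: GL_def invertible_left_inverse)
  \<comment> \<open>Both sides have \<open>v i\<close> as column \<open>i\<close> and zero in all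
    other columns.\<close>
  have "p i ** g = g ** coord_projector i" for i
  proof -
    have "(p i ** g) $ k $ j = (p i *v v j) $ k" for k j
      by (simp add: matrix_matrix_mult_def matrix_vector_mult_def g_def)
    moreover have "(g ** coord_projector i) $ k $ j = (\<Sum>a\<in>UNIV. if a = i then if j = i then v i $ k else 0 else 0)" for k j
      unfolding matrix_matrix_mult_def coord_projector_def vec_lambda_beta
      by (intro sum.cong) (auto simp: g_def)
    ultimately show ?thesis
      by (auto simp: vec_eq_iff v v0)
  qed
  then show ?thesis
    using g conj_system_eq_iff[OF g] by blast
qed

section \<open>The bijection between cosets and complete systems\<close>

text \<open>For \<open>a \<noteq> b\<close>, the entry at \<open>(a, b)\<close> is
  \<open>t $ a $ b\<close> in \<open>t ** coord_projector b\<close>, but 0 in the product in the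
  other order.\<close>

lemma commutes_coord_projectors_imp_torus:
  assumes t: "t \<in> GL" "\<And>i. t ** coord_projector i = coord_projector i ** t"
  shows "t \<in> torus"
proof -
  have "t $ a $ b = 0" if "a \<noteq> b" for a b
  proof -
    have "(t ** coord_projector b) $ a $ b = (\<Sum>m\<in>UNIV. if m = b then t $ a $ b else 0)"
      unfolding matrix_matrix_mult_def coord_projector_def vec_lambda_beta
      by (intro sum.cong) auto
    moreover have "(coord_projector b ** t) $ a $ b = 0"
      using that unfolding matrix_matrix_mult_def coord_projector_def vec_lambda_beta
      by (intro sum.neutral) auto
    ultimately show ?thesis
      using t(2)[of b] by simp
  qed
  then show ?thesis
    using t(1) by (simp add: torus_def)
qed

text \<open>Equal conjugates mean that \<open>matrix_inv g ** h\<close> commutes with every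
  coordinate projector and so lies in the torus; it carries \<open>g\<close> to
  \<open>h\<close>.\<close>

lemma torus_coset_eqI:
  assumes g: "g \<in> GL" and h: "h \<in> GL" and eq: "conj_system g = conj_system h"
  shows "torus_coset g = torus_coset h"
proof -
  let ?t = "matrix_inv g ** h"
  note inv = matrix_mult_matrix_inv[OF g]
  have "?t \<in> GL"
    using h inv unfolding GL_def by (auto simp: invertible_def[of "matrix_inv g"] intro!: invertible_mult)
  moreover have "?t ** coord_projector i = coord_projector i ** ?t" for i
  proof -
    have "conj_system g i ** h = h ** coord_projector i"
      using conj_system_eq_iff[OF h, of i "conj_system g i"] eq by simp
    then have "g ** coord_projector i ** ?t = h ** coord_projector i"
      by (simp add: conj_system_def matrix_mul_assoc)
    then have "matrix_inv g ** g ** coord_projector i ** ?t = matrix_inv g ** h ** coord_projector i"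
      by (metis matrix_mul_assoc)
    then show ?thesis
      by (simp add: inv)
  qed
  ultimately have "?t \<in> torus"
    by (rule commutes_coord_projectors_imp_torus)
  moreover have "g ** ?t = h"
    by (simp add: matrix_mul_assoc inv)
  ultimately show ?thesis
    using torus_coset_mult[of ?t g] by simp
qed

lemma bij_betw_coset_system:
  "bij_betw coset_system (GL_mod_torus :: (complex^'n^'n) set set) {p. complete_system p}"
proof (rule bij_betw_imageI)
  show "inj_on coset_system (GL_mod_torus :: (complex^'n^'n) set set)"
  proof (rule inj_onI)
    fix x y :: "(complex^'n^'n) set"
    assume "x \<in> GL_mod_torus" "y \<in> GL_mod_torus" and eq: "coset_system x = coset_system y"
    then obtain g h where "g \<in> GL" "h \<in> GL" "x = torus_coset g" "y = torus_coset h"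
      by (auto simp: GL_mod_torus_def)
    then show "x = y"
      using eq torus_coset_eqI[of g h] by (simp add: coset_system_torus_coset)
  qed
  show "coset_system ` (GL_mod_torus :: (complex^'n^'n) set set) = {p. complete_system p}"
  proof
    show "coset_system ` (GL_mod_torus :: (complex^'n^'n) set set) \<subseteq> {p. complete_system p}"
      by (auto simp: GL_mod_torus_def coset_system_torus_coset complete_system_conj_system)
  next
    show "{p. complete_system p} \<subseteq> coset_system ` (GL_mod_torus :: (complex^'n^'n) set set)"
    proof
      fix p :: "'n \<Rightarrow> complex^'n^'n"
      assume "p \<in> {p. complete_system p}"
      then obtain g where "g \<in> GL" "conj_system g = p"
        using complete_system_imp_conj_system by blast
      then have "p = coset_system (torus_coset g)" "torus_coset g \<in> GL_mod_torus"
        by (simp_all add: coset_system_torus_coset GL_mod_torus_def)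
      then show "p \<in> coset_system ` GL_mod_torus"
        by (rule image_eqI)
    qed
  qed
qed

theorem proposition8:
  fixes \<Lambda> :: "complex^'n^'n"
  assumes "\<And>i j. \<Lambda> $ i $ j \<noteq> 0"
    and "\<And>j. (\<Sum>i\<in>UNIV. \<Lambda> $ i $ j) = 1"
    and "\<And>i. (\<Sum>j\<in>UNIV. \<Lambda> $ i $ j) = 1"
  shows "critical_points \<Lambda> =
           {x \<in> GL_mod_torus. \<forall>i j. trace (coset_system x i ** coord_projector j) = \<Lambda> $ i $ j} \<and>
         bij_betw coset_system (critical_points \<Lambda>)
           {p. complete_system p \<and> (\<forall>i j. trace (p i ** coord_projector j) = \<Lambda> $ i $ j)}"
proof
  show eq: "critical_points \<Lambda> =
      {x \<in> GL_mod_torus. \<forall>i j. trace (coset_system x i ** coord_projector j) = \<Lambda> $ i $ j}"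
    using assms(1,3) by (rule critical_points_eq)
  show "bij_betw coset_system (critical_points \<Lambda>)
      {p. complete_system p \<and> (\<forall>i j. trace (p i ** coord_projector j) = \<Lambda> $ i $ j)}"
    \<comment> \<open>The trace equations for a coset are those for its image, so the bijection
      restricts to the two solution sets.\<close>
    unfolding eq using bij_betw_Collect[OF bij_betw_coset_system, where
        P="\<lambda>x. \<forall>i j. trace (coset_system x i ** coord_projector j) = \<Lambda> $ i $ j" and
        Q="\<lambda>p. \<forall>i j. trace (p i ** coord_projector j) = \<Lambda> $ i $ j"] by simp
qed

end
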